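(* There are positive constants $d_{3\text{-col.}}$ and $\varepsilon_{3\text{-col.}}$ such that, in the bounded degree model with degree bound $d_{3\text{-col.}}$ and proximity parameter $\varepsilon_{3\text{-col.}}$, the query complexity of testing $3$-colorability of $3$-uniform $n$-vertex hypergraphs is $\Omega(n)$.
   Context: A hypergraph is $3$-uniform if every hyperedge has exactly $3$ vertices; it is $3$-colorable if there is a map $V(H)\to\{1,2,3\}$ such that every hyperedge contains two vertices of different colors. Bounded degree model: a hypergraph of maximum degree at most $\Delta$ is accessed via queries to lists $A_1,\dots,A_n$ of length $\Delta$, $A_i$ listing the hyperedges incident to vertex $i$ padded with $\bot$. Distance between $H_1=([n],E_1)$, $H_2=([n],E_2)$ is $(|E_1\setminus E_2|+|E_2\setminus E_1|)/(\Delta n)$; $H$ is $\varepsilon$-far from a property if its distance to every $3$-uniform $n$-vertex hypergraph with the property exceeds $\varepsilon$. An $\varepsilon$-tester accepts with probability $\ge 2/3$ inputs having the property and with probability $\le 1/3$ inputs $\varepsilon$-far from it; "query complexity $\Omega(n)$" means every such tester makes $\Omega(n)$ queries in the worst case. *)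

theory Defs
  imports "HOL-Probability.Probability" "HOL-Library.Landau_Symbols"
begin

type_synonym hyperedges = "nat set set"

definition three_uniform :: "nat \<Rightarrow> hyperedges \<Rightarrow> bool" where
  "three_uniform n E \<longleftrightarrow> (\<forall>e\<in>E. e \<subseteq> {1..n} \<and> card e = 3)"

definition three_colorable :: "nat \<Rightarrow> hyperedges \<Rightarrow> bool" where
  "three_colorable n E \<longleftrightarrow>
     (\<exists>c \<in> {1..n} \<rightarrow> {1, 2, 3 :: nat}. \<forall>e\<in>E. \<exists>u\<in>e. \<exists>v\<in>e. c u \<noteq> c v)"

definition hdist :: "nat \<Rightarrow> nat \<Rightarrow> hyperedges \<Rightarrow> hyperedges \<Rightarrow> real" where
  "hdist d n E\<^sub>1 E\<^sub>2 = real (card (E\<^sub>1 - E\<^sub>2) + card (E\<^sub>2 - E\<^sub>1)) / (real d * real n)"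

text \<open>The comparison hypergraph \<open>E'\<close> below is not required to have degree at most \<open>d\<close>.\<close>

definition far_from ::
    "(nat \<Rightarrow> hyperedges \<Rightarrow> bool) \<Rightarrow> nat \<Rightarrow> real \<Rightarrow> nat \<Rightarrow> hyperedges \<Rightarrow> bool" where
  "far_from P d \<epsilon> n E \<longleftrightarrow>
     (\<forall>E'. three_uniform n E' \<and> P n E' \<longrightarrow> hdist d n E E' > \<epsilon>)"

text \<open>
  An input to a tester is a family of incidence lists.  The order in which the hyperedges at a
  vertex are listed is arbitrary, and \<open>None\<close> plays the role of the padding symbol.  The existence
  of such lists forces every vertex to have degree at most \<open>d\<close>.
\<close>

type_synonym incidence_lists = "nat \<Rightarrow> nat set option list"

definition represents :: "nat \<Rightarrow> nat \<Rightarrow> hyperedges \<Rightarrow> incidence_lists \<Rightarrow> bool" where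
  "represents d n E A \<longleftrightarrow>
     (\<forall>i\<in>{1..n}. \<exists>es. distinct es \<and> set es = {e\<in>E. i \<in> e} \<and> length es \<le> d \<and>
        A i = map Some es @ replicate (d - length es) None)"

text \<open>
  A deterministic adaptive query algorithm is a decision tree: \<open>Query i j k\<close> reads entry \<open>j\<close>
  (counted from 0) of the list of vertex \<open>i\<close> and continues with the tree that \<open>k\<close> assigns to the
  answer.  Queries with \<open>i \<notin> {1..n}\<close> or \<open>j \<ge> d\<close> are not excluded, but they carry no information:
  \<^const>\<open>represents\<close> leaves the lists outside \<open>{1..n}\<close> arbitrary, and out-of-range list access
  depends only on the length of the list.
\<close>

datatype query_tree =
    Decide bool
  | Query nat nat "nat set option \<Rightarrow> query_tree"

primrec accepts :: "query_tree \<Rightarrow> incidence_lists \<Rightarrow> bool" where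
  "accepts (Decide b) A = b"
| "accepts (Query i j k) A = accepts (k (A i ! j)) A"

primrec num_queries :: "query_tree \<Rightarrow> incidence_lists \<Rightarrow> nat" where
  "num_queries (Decide b) A = 0"
| "num_queries (Query i j k) A = Suc (num_queries (k (A i ! j)) A)"

text \<open>
  A randomized algorithm for \<open>n\<close>-vertex inputs is a probability distribution over decision trees
  (all coins are tossed before the first query).  It may depend on \<open>n\<close>, \<open>d\<close>, \<open>\<epsilon>\<close> in an arbitrary way.
\<close>

definition is_tester ::
    "(nat \<Rightarrow> hyperedges \<Rightarrow> bool) \<Rightarrow> nat \<Rightarrow> real \<Rightarrow> nat \<Rightarrow> query_tree pmf \<Rightarrow> bool" where
  "is_tester P d \<epsilon> n T \<longleftrightarrow>
     (\<forall>E A. three_uniform n E \<and> represents d n E A \<longrightarrow>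
        (P n E \<longrightarrow> measure_pmf.prob T {t. accepts t A} \<ge> 2/3) \<and>
        (far_from P d \<epsilon> n E \<longrightarrow> measure_pmf.prob T {t. accepts t A} \<le> 1/3))"

definition makes_at_most :: "nat \<Rightarrow> nat \<Rightarrow> query_tree pmf \<Rightarrow> nat \<Rightarrow> bool" where
  "makes_at_most d n T q \<longleftrightarrow>
     (\<forall>E A. three_uniform n E \<and> represents d n E A \<longrightarrow> (\<forall>t\<in>set_pmf T. num_queries t A \<le> q))"

definition query_complexity ::
    "(nat \<Rightarrow> hyperedges \<Rightarrow> bool) \<Rightarrow> nat \<Rightarrow> real \<Rightarrow> nat \<Rightarrow> nat" where
  "query_complexity P d \<epsilon> n = (LEAST q. \<exists>T. is_tester P d \<epsilon> n T \<and> makes_at_most d n T q)"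

text \<open>
  The minimum is over a nonempty set: reading all lists and deciding exactly is a tester.
\<close>

primrec read_all ::
    "(nat \<times> nat) list \<Rightarrow> (nat \<times> nat \<Rightarrow> nat set option) \<Rightarrow>
     ((nat \<times> nat \<Rightarrow> nat set option) \<Rightarrow> bool) \<Rightarrow> query_tree" where
  "read_all [] f D = Decide (D f)"
| "read_all (p # ps) f D = Query (fst p) (snd p) (\<lambda>a. read_all ps (f(p := a)) D)"

lemma num_queries_read_all: "num_queries (read_all ps f D) A = length ps"
  by (induction ps arbitrary: f) auto

lemma accepts_read_all:
  "accepts (read_all ps f D) A =
     D (\<lambda>p. if p \<in> set ps then A (fst p) ! snd p else f p)"
  by (induction ps arbitrary: f) (auto intro!: arg_cong[where f = D] simp: fun_eq_iff)

lemma represents_length: "represents d n E A \<Longrightarrow> i \<in> {1..n} \<Longrightarrow> length (A i) = d"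
  unfolding represents_def by force

lemma represents_unique:
  assumes "three_uniform n E" "three_uniform n E'" "represents d n E A" "represents d n E' A"
  shows "E \<subseteq> E'"
proof
  fix e assume e: "e \<in> E"
  then have "e \<noteq> {}" "e \<subseteq> {1..n}" using assms(1) by (auto simp: three_uniform_def)
  then obtain i where i: "i \<in> e" "i \<in> {1..n}" by blast
  obtain es where es: "set es = {e\<in>E. i \<in> e}"
    "A i = map Some es @ replicate (d - length es) None"
    using assms(3) i(2) unfolding represents_def by blast
  obtain es' where es': "set es' = {e\<in>E'. i \<in> e}"
    "A i = map Some es' @ replicate (d - length es') None"
    using assms(4) i(2) unfolding represents_def by blast
  have "Some e \<in> set (A i)" using es e i by simp
  then have "e \<in> set es'" using es'(2) by auto
  then show "e \<in> E'" using es'(1) by blast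
qed

lemma represents_cong:
  "(\<And>i. i \<in> {1..n} \<Longrightarrow> A i = B i) \<Longrightarrow> represents d n E A \<longleftrightarrow> represents d n E B"
  unfolding represents_def by auto

lemma tester_exists:
  assumes "\<epsilon> \<ge> 0"
  shows "\<exists>q T. is_tester P d \<epsilon> n T \<and> makes_at_most d n T q"
proof -
  define ps where "ps = List.product [1..<Suc n] [0..<d]"
  define D where "D = (\<lambda>f. \<exists>E. three_uniform n E \<and> P n E \<and>
     represents d n E (\<lambda>i. map (\<lambda>j. f (i, j)) [0..<d]))"
  define t where "t = read_all ps (\<lambda>_. None) D"
  have acc: "accepts t A \<longleftrightarrow> P n E"
    if E: "three_uniform n E" "represents d n E A" for E A
  proof -
    have "represents d n F (\<lambda>i. map (\<lambda>j. if (i, j) \<in> set ps then A i ! j else None) [0..<d])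
        \<longleftrightarrow> represents d n F A" for F
      using represents_length[OF E(2)]
      by (intro represents_cong nth_equalityI) (auto simp: ps_def)
    then have "accepts t A \<longleftrightarrow> (\<exists>F. three_uniform n F \<and> P n F \<and> represents d n F A)"
      by (simp add: t_def accepts_read_all D_def cong: if_cong)
    also have "\<dots> \<longleftrightarrow> P n E"
    proof -
      have "F = E" if "three_uniform n F" "represents d n F A" for F
        using represents_unique[OF that(1) E(1) that(2) E(2)]
          represents_unique[OF E(1) that(1) E(2) that(2)] by (rule subset_antisym)
      then show ?thesis using E by blast
    qed
    finally show ?thesis .
  qed
  have "is_tester P d \<epsilon> n (return_pmf t)"
    unfolding is_tester_def
  proof (intro allI impI conjI; elim conjE)
    fix E A assume E: "three_uniform n E" "represents d n E A"
    show "2/3 \<le> measure_pmf.prob (return_pmf t) {t. accepts t A}" if "P n E"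
      using acc[OF E] that by (simp add: measure_return_pmf)
    show "measure_pmf.prob (return_pmf t) {t. accepts t A} \<le> 1/3" if "far_from P d \<epsilon> n E"
    proof -
      have "\<not> P n E"
      proof
        assume "P n E"
        then have "hdist d n E E > \<epsilon>" using that E(1) by (auto simp: far_from_def)
        then show False using assms by (simp add: hdist_def)
      qed
      then show ?thesis using acc[OF E] by (simp add: measure_return_pmf)
    qed
  qed
  moreover have "makes_at_most d n (return_pmf t) (length ps)"
    by (simp add: makes_at_most_def t_def num_queries_read_all)
  ultimately show ?thesis by blast
qed

lemma query_complexity_attained:
  assumes "\<epsilon> \<ge> 0"
  shows "\<exists>T. is_tester P d \<epsilon> n T \<and> makes_at_most d n T (query_complexity P d \<epsilon> n)"
  unfolding query_complexity_def by (rule LeastI_ex) (rule tester_exists[OF assms])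

end

theory Submission
  imports Defs
begin

text \<open>
  Fix a \<open>3\<close>-uniform hypergraph \<open>F\<close> of bounded degree such that every \<open>3\<close>-coloring makes at least
  \<open>6n\<close> hyperedges monochromatic, and such that every nonempty set of at most \<open>\<delta>n\<close> hyperedges has
  a vertex lying in exactly one of them; a random hypergraph without the hyperedges at its
  high-degree vertices will do.  An assignment \<open>b\<close> of elements of \<open>\<int>/3\<close> to the hyperedges
  determines the input that keeps the hyperedges with \<open>b e \<noteq> 0\<close>.  If \<open>b e\<close> is the sum of \<open>x\<close> over
  the vertices of \<open>e\<close>, then \<open>x\<close> is a proper coloring of this input, since a monochromatic triple
  has sum \<open>3a = 0\<close>.  If \<open>b\<close> is uniformly random, then the input is far from \<open>3\<close>-colorable with
  high probability, by a union bound over the colorings.  A query reveals at most \<open>d\<close> values of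
  \<open>b\<close>, and by the unique neighbor property any \<open>\<delta>n\<close> values of \<open>b\<close> are uniformly distributed in
  both cases, so that \<open>\<delta>n/d\<close> queries cannot tell the two cases apart.
\<close>

subsection \<open>Functions with few hits\<close>

lemma prod_sum_PiE_const:
  fixes g :: "'i \<Rightarrow> 'x \<Rightarrow> real"
  assumes "finite I" "finite X"
  shows "(\<Sum>h\<in>I \<rightarrow>\<^sub>E X. \<Prod>i\<in>I. g i (h i)) = (\<Prod>i\<in>I. \<Sum>x\<in>X. g i x)"
  using prod_sum_PiE[of I "\<lambda>_. X" g] assms by simp

text \<open>A Chernoff bound in counting form: give \<open>h\<close> the weight 1/2 to the power of
  its number of hits. Fewer than \<open>k\<close> hits force weight at least
  \<open>1 / 2 ^ k\<close>, while the total weight of all functions factors over the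
  coordinates.\<close>

lemma card_few_hits:
  fixes Y :: "'i \<Rightarrow> 'x set"
  assumes I: "finite I" and X: "finite X" and Y: "\<And>i. i \<in> I \<Longrightarrow> Y i \<subseteq> X"
  shows "real (card {h \<in> I \<rightarrow>\<^sub>E X. card {i\<in>I. h i \<in> Y i} < k})
         \<le> 2 ^ k * (\<Prod>i\<in>I. real (card X) - real (card (Y i)) / 2)"
proof -
  let ?H = "I \<rightarrow>\<^sub>E X"
  let ?wt = "\<lambda>h. \<Prod>i\<in>I. if h i \<in> Y i then 1/2 else (1::real)"
  have fin: "finite ?H" using I X by (simp add: finite_PiE)
  have wt: "?wt h = (1/2) ^ card {i\<in>I. h i \<in> Y i}" for h
    using I by (simp add: prod.If_cases Int_def)
  have "real (card {h \<in> ?H. card {i\<in>I. h i \<in> Y i} < k})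
        = (\<Sum>h | h \<in> ?H \<and> card {i\<in>I. h i \<in> Y i} < k. 1)" by simp
  also have "\<dots> \<le> (\<Sum>h | h \<in> ?H \<and> card {i\<in>I. h i \<in> Y i} < k. 2 ^ k * ?wt h)"
  proof (rule sum_mono)
    fix h assume "h \<in> {h. h \<in> ?H \<and> card {i\<in>I. h i \<in> Y i} < k}"
    then have "(1/2::real) ^ k \<le> ?wt h" unfolding wt by (intro power_decreasing) auto
    then have "2 ^ k * (1/2::real) ^ k \<le> 2 ^ k * ?wt h" by simp
    then show "1 \<le> 2 ^ k * ?wt h" by (simp flip: power_mult_distrib)
  qed
  also have "\<dots> \<le> (\<Sum>h\<in>?H. 2 ^ k * ?wt h)"
    by (rule sum_mono2[OF fin]) (auto intro!: mult_nonneg_nonneg prod_nonneg)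
  also have "\<dots> = 2 ^ k * (\<Prod>i\<in>I. \<Sum>x\<in>X. if x \<in> Y i then 1/2 else 1)"
    by (subst prod_sum_PiE_const[OF I X, of "\<lambda>i x. if x \<in> Y i then 1/2 else 1", symmetric])
      (simp add: sum_distrib_left)
  also have "(\<Prod>i\<in>I. \<Sum>x\<in>X. if x \<in> Y i then 1/2 else 1)
             = (\<Prod>i\<in>I. real (card X) - real (card (Y i)) / 2)"
  proof (rule prod.cong)
    fix i assume i: "i \<in> I"
    have "(\<Sum>x\<in>X. if x \<in> Y i then 1/2 else (1::real)) = (\<Sum>x\<in>X. 1 - (if x \<in> Y i then 1/2 else 0))"
      by (rule sum.cong) auto
    also have "\<dots> = real (card X) - (\<Sum>x\<in>X. if x \<in> Y i then 1/2 else 0)"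
      by (simp add: sum_subtractf)
    also have "(\<Sum>x\<in>X. if x \<in> Y i then 1/2 else (0::real)) = real (card (Y i)) / 2"
      using X Y[OF i] by (simp add: sum.If_cases Int_absorb1)
    finally show "(\<Sum>x\<in>X. if x \<in> Y i then 1/2 else 1) = real (card X) - real (card (Y i)) / 2" .
  qed simp
  finally show ?thesis .
qed

subsection \<open>Decision trees and locally vanishing weights\<close>

text \<open>
  The signed weight \<open>w\<close> is the difference of two probability distributions that have the same
  marginals on all sets of at most \<open>k\<close> coordinates; \<open>K\<close> is the set of coordinates revealed so far.
\<close>

lemma sum_accepting_eq_0:
  fixes w :: "('e \<Rightarrow> 'c) \<Rightarrow> real"
  assumes B: "finite B"
    and local: "\<And>i b b'. b \<in> B \<Longrightarrow> b' \<in> B \<Longrightarrow> (\<forall>e\<in>N i. b e = b' e) \<Longrightarrow> A b i = A b' i"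
    and N: "\<And>i. N i \<subseteq> F" "\<And>i. card (N i) \<le> d" and F: "finite F"
    and zero: "\<And>K b\<^sub>0. K \<subseteq> F \<Longrightarrow> card K \<le> k \<Longrightarrow> b\<^sub>0 \<in> B \<Longrightarrow>
                 (\<Sum>b | b \<in> B \<and> (\<forall>e\<in>K. b e = b\<^sub>0 e). w b) = 0"
  shows "K \<subseteq> F \<Longrightarrow> card K + d * q \<le> k \<Longrightarrow> b\<^sub>0 \<in> B \<Longrightarrow>
    (\<And>b. b \<in> B \<Longrightarrow> \<forall>e\<in>K. b e = b\<^sub>0 e \<Longrightarrow> num_queries t (A b) \<le> q) \<Longrightarrow>
    (\<Sum>b | b \<in> B \<and> (\<forall>e\<in>K. b e = b\<^sub>0 e) \<and> accepts t (A b). w b) = 0"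
proof (induction t arbitrary: K q b\<^sub>0)
  case (Decide r)
  then show ?case using zero[of K b\<^sub>0] by (cases r) auto
next
  case (Query i j s)
  \<comment> \<open>The tree starts with a query, so running it on \<open>A b\<^sub>0\<close> shows
    that \<open>q\<close> is positive.\<close>
  define q' where "q' = q - 1"
  have q: "q = Suc q'" using Query.prems(4)[of b\<^sub>0] Query.prems(3) by (auto simp: q'_def)
  \<comment> \<open>The whole list of \<open>i\<close> is a function of the coordinates in
    \<open>N i\<close>. Adding them to the revealed set fixes the answer to this query and costs at
    most \<open>d\<close> coordinates.\<close>
  define K' where "K' = K \<union> N i"
  have K': "K' \<subseteq> F" using Query.prems(1) N by (auto simp: K'_def)
  have "card K' \<le> card K + d"
    using card_Un_le[of K "N i"] N(2)[of i] by (simp add: K'_def)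
  then have cK': "card K' + d * q' \<le> k" using Query.prems(2) by (simp add: q)
  define S where "S = {b \<in> B. (\<forall>e\<in>K. b e = b\<^sub>0 e) \<and> accepts (Query i j s) (A b)}"
  have S: "finite S" using B by (simp add: S_def)
  \<comment> \<open>Split by the values on \<open>K'\<close>. Within one class every input gives the
    same answer, so the class is an instance of the induction hypothesis for a single subtree, with
    any member \<open>b\<^sub>1\<close> as reference point.\<close>
  have "sum w S = (\<Sum>r\<in>(\<lambda>b. restrict b K') ` S. sum w {b\<in>S. restrict b K' = r})"
    by (rule sum.image_gen[OF S])
  also have "\<dots> = 0"
  proof (rule sum.neutral, safe)
    fix b\<^sub>1 assume b1: "b\<^sub>1 \<in> S"
    let ?t = "s (A b\<^sub>1 i ! j)"
    have same: "A b i = A b\<^sub>1 i" if "b \<in> B" "\<forall>e\<in>K'. b e = b\<^sub>1 e" for b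
      using that b1 by (intro local) (auto simp: S_def K'_def)
    have "{b\<in>S. restrict b K' = restrict b\<^sub>1 K'}
          = {b. b \<in> B \<and> (\<forall>e\<in>K'. b e = b\<^sub>1 e) \<and> accepts ?t (A b)}" (is "?L = ?R")
    proof (intro set_eqI iffI)
      fix b assume b: "b \<in> ?L"
      then have "\<forall>e\<in>K'. b e = b\<^sub>1 e" by (metis (mono_tags, lifting) mem_Collect_eq restrict_apply')
      then show "b \<in> ?R" using b same[of b] by (auto simp: S_def)
    next
      fix b assume b: "b \<in> ?R"
      then have "restrict b K' = restrict b\<^sub>1 K'" by auto
      moreover have "\<forall>e\<in>K. b e = b\<^sub>0 e" using b b1 by (auto simp: S_def K'_def)
      ultimately show "b \<in> ?L" using b same[of b] by (auto simp: S_def)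
    qed
    moreover have "sum w {b. b \<in> B \<and> (\<forall>e\<in>K'. b e = b\<^sub>1 e) \<and> accepts ?t (A b)} = 0"
    proof (rule Query.IH[of ?t K' q' b\<^sub>1, OF _ K' cK'])
      show "b\<^sub>1 \<in> B" using b1 by (simp add: S_def)
      fix b assume b: "b \<in> B" "\<forall>e\<in>K'. b e = b\<^sub>1 e"
      have "\<forall>e\<in>K. b e = b\<^sub>0 e" using b b1 by (auto simp: S_def K'_def)
      from Query.prems(4)[OF b(1) this] show "num_queries ?t (A b) \<le> q'"
        by (simp add: q same[OF b])
    qed simp
    ultimately show "sum w {b\<in>S. restrict b K' = restrict b\<^sub>1 K'} = 0" by simp
  qed
  finally show ?case by (simp add: S_def)
qed

subsection \<open>Uniformity of edge sums\<close>

text \<open>The type \<open>3\<close> is the ring of integers modulo 3. The factor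
  \<open>3 ^ card K\<close> expresses the uniform marginal on \<open>K\<close> without leaving the
  natural numbers.\<close>

lemma card_PiE_agree:
  assumes "finite F" "K \<subseteq> F" "b\<^sub>0 \<in> F \<rightarrow>\<^sub>E (UNIV :: 3 set)"
  shows "card {b \<in> F \<rightarrow>\<^sub>E (UNIV :: 3 set). \<forall>e\<in>K. b e = b\<^sub>0 e} * 3 ^ card K = 3 ^ card F"
proof -
  have "{b \<in> F \<rightarrow>\<^sub>E (UNIV :: 3 set). \<forall>e\<in>K. b e = b\<^sub>0 e}
        = PiE F (\<lambda>e. if e \<in> K then {b\<^sub>0 e} else UNIV)"
    (is "?L = ?R")
  proof (intro set_eqI iffI)
    fix b assume "b \<in> ?L" then show "b \<in> ?R" by (simp add: PiE_iff)
  next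
    fix b assume b: "b \<in> ?R"
    have "b e = b\<^sub>0 e" if "e \<in> K" for e
      using PiE_mem[OF b, of e] that assms(2) by auto
    then show "b \<in> ?L" using b by (simp add: PiE_iff)
  qed
  then have "card {b \<in> F \<rightarrow>\<^sub>E (UNIV :: 3 set). \<forall>e\<in>K. b e = b\<^sub>0 e}
        = (\<Prod>e\<in>F. if e \<in> K then 1 else 3)"
    using assms(1) by (simp add: card_PiE if_distrib cong: if_cong)
  also have "\<dots> = 3 ^ card (F - K)" using assms(1) by (simp add: prod.If_cases Diff_eq)
  finally have "card {b \<in> F \<rightarrow>\<^sub>E (UNIV :: 3 set). \<forall>e\<in>K. b e = b\<^sub>0 e} * 3 ^ card K = 3 ^ (card (F - K) + card K)"
    by (simp add: power_add)
  also have "card (F - K) + card K = card F"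
    using assms(1,2) by (metis add.commute card_Un_disjoint Diff_disjoint Un_Diff_cancel Un_absorb1 finite_subset finite_Diff)
  finally show ?thesis .
qed

definition edge_sum :: "('v \<Rightarrow> 3) \<Rightarrow> 'v set \<Rightarrow> 3" where
  "edge_sum x e = (\<Sum>v\<in>e. x v)"

definition unique_neighbor :: "'v set set \<Rightarrow> bool" where
  "unique_neighbor K \<longleftrightarrow> (\<exists>e\<in>K. \<exists>v\<in>e. \<forall>e'\<in>K. v \<in> e' \<longrightarrow> e' = e)"

text \<open>Peel off a hyperedge \<open>e\<close> with a vertex \<open>v\<close> in no other member
  of \<open>K\<close>. Changing \<open>x v\<close> moves the sum over \<open>e\<close> through all
  residues and leaves the other sums alone, so the condition at \<open>e\<close> keeps exactly a
  third of the solutions. The remaining family inherits the hypothesis, and induction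
  applies.\<close>

lemma card_edge_sum_agree:
  assumes V: "finite V" and K: "finite K" "\<And>e. e \<in> K \<Longrightarrow> e \<subseteq> V"
    and un: "\<And>K'. K' \<subseteq> K \<Longrightarrow> K' \<noteq> {} \<Longrightarrow> unique_neighbor K'"
  shows "card {x \<in> V \<rightarrow>\<^sub>E (UNIV :: 3 set). \<forall>e\<in>K. edge_sum x e = \<beta> e} * 3 ^ card K = 3 ^ card V"
  using K un
proof (induction "card K" arbitrary: K)
  case 0
  then have "K = {}" by simp
  then show ?case using V by (simp add: card_PiE)
next
  case (Suc r)
  then have "K \<noteq> {}" by auto
  then obtain e v where e: "e \<in> K" "v \<in> e" "\<And>e'. e' \<in> K \<Longrightarrow> v \<in> e' \<Longrightarrow> e' = e"
    using Suc.prems(3)[of K] unfolding unique_neighbor_def by blast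
  let ?K = "K - {e}"
  let ?X = "V \<rightarrow>\<^sub>E (UNIV :: 3 set)"
  define X where "X r = {x \<in> ?X. (\<forall>e'\<in>?K. edge_sum x e' = \<beta> e') \<and> edge_sum x e = r}" for r
  have finX: "finite ?X" using V by (simp add: finite_PiE)
  have vV: "v \<in> V" and fe: "finite e" using Suc.prems(2)[OF e(1)] e(2) V by (auto intro: finite_subset)
  have shift: "x(v := x v + t) \<in> X (r + t)" if "x \<in> X r" for x r t
  proof -
    have "edge_sum (x(v := x v + t)) e' = edge_sum x e'" if "e' \<in> ?K" for e'
      unfolding edge_sum_def using that e(3) by (intro sum.cong) auto
    moreover have "edge_sum (x(v := x v + t)) e = edge_sum x e + t"
    proof -
      have "edge_sum (x(v := x v + t)) e = (x v + t) + (\<Sum>u\<in>e-{v}. x u)"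
        unfolding edge_sum_def using e(2) fe by (subst sum.remove[of _ v]) auto
      also have "\<dots> = edge_sum x e + t"
        unfolding edge_sum_def using e(2) fe by (subst (2) sum.remove[of _ v]) (auto simp: algebra_simps)
      finally show ?thesis .
    qed
    ultimately show ?thesis using that vV by (auto simp: X_def PiE_iff extensional_def)
  qed
  \<comment> \<open>Since \<open>r\<close> and \<open>r'\<close> are arbitrary, these injections
    make the three fibers equally large.\<close>
  have le: "card (X r) \<le> card (X r')" for r r'
  proof (rule card_inj_on_le[of "\<lambda>x. x(v := x v + (r' - r))"])
    show "inj_on (\<lambda>x. x(v := x v + (r' - r))) (X r)"
    proof (rule inj_on_inverseI[of _ "\<lambda>x. x(v := x v - (r' - r))"])
    qed simp
    show "(\<lambda>x. x(v := x v + (r' - r))) ` X r \<subseteq> X r'" using shift[of _ r "r' - r"] by auto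
    show "finite (X r')" using finX by (simp add: X_def)
  qed
  then have eq: "card (X r) = card (X (\<beta> e))" for r by (simp add: le_antisym)
  have "{x \<in> ?X. \<forall>e\<in>?K. edge_sum x e = \<beta> e} = (\<Union>r\<in>UNIV. X r)" by (auto simp: X_def)
  then have "card {x \<in> ?X. \<forall>e\<in>?K. edge_sum x e = \<beta> e} = (\<Sum>r\<in>UNIV. card (X r))"
    using finX by (subst card_UN_disjoint[symmetric]) (auto simp: X_def)
  also have "\<dots> = 3 * card (X (\<beta> e))" by (subst eq) simp
  also have "X (\<beta> e) = {x \<in> ?X. \<forall>e\<in>K. edge_sum x e = \<beta> e}" using e(1) by (auto simp: X_def)
  finally have "card {x \<in> ?X. \<forall>e\<in>?K. edge_sum x e = \<beta> e}
                = 3 * card {x \<in> ?X. \<forall>e\<in>K. edge_sum x e = \<beta> e}" .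
  moreover have "card {x \<in> ?X. \<forall>e\<in>?K. edge_sum x e = \<beta> e} * 3 ^ card ?K = 3 ^ card V"
  proof (rule Suc.hyps(1))
    show "r = card ?K" using Suc.hyps(2) e(1) Suc.prems(1) by simp
    show "unique_neighbor K'" if "K' \<subseteq> ?K" "K' \<noteq> {}" for K'
      using that by (intro Suc.prems(3)) auto
  qed (use Suc.prems(1,2) in auto)
  moreover have "card K = Suc (card ?K)" using e(1) Suc.prems(1) by (metis card_Suc_Diff1)
  ultimately show ?case by simp
qed

subsection \<open>The inputs and the query bound\<close>

text \<open>The order is chosen as a function of the set of hyperedges at \<open>i\<close> alone.
  Hence two inputs that agree at \<open>i\<close> have identical lists there, and a query at
  \<open>i\<close> reveals nothing about other hyperedges.\<close>

definition incidence_list :: "nat \<Rightarrow> hyperedges \<Rightarrow> incidence_lists" where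
  "incidence_list d E i =
     (let es = SOME es. distinct es \<and> set es = {e\<in>E. i \<in> e}
      in map Some es @ replicate (d - length es) None)"

lemma represents_incidence_list:
  assumes "finite E" "\<And>v. card {e\<in>E. v \<in> e} \<le> d"
  shows "represents d n E (incidence_list d E)"
  unfolding represents_def
proof
  fix i
  define es where "es = (SOME es. distinct es \<and> set es = {e\<in>E. i \<in> e})"
  have "\<exists>es. distinct es \<and> set es = {e\<in>E. i \<in> e}"
    using finite_distinct_list[of "{e\<in>E. i \<in> e}"] assms(1) by auto
  then have es: "distinct es \<and> set es = {e\<in>E. i \<in> e}" unfolding es_def by (rule someI_ex)
  then have "length es \<le> d" using assms(2)[of i] by (metis distinct_card)
  then show "\<exists>es. distinct es \<and> set es = {e\<in>E. i \<in> e} \<and> length es \<le> d \<and>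
      incidence_list d E i = map Some es @ replicate (d - length es) None"
    using es by (intro exI[of _ es]) (simp add: incidence_list_def es_def Let_def)
qed

lemma incidence_list_cong:
  "{e\<in>E. i \<in> e} = {e\<in>E'. i \<in> e} \<Longrightarrow> incidence_list d E i = incidence_list d E' i"
  by (simp add: incidence_list_def)

section \<open>Colorability and farness of the inputs\<close>

definition kept :: "'e set \<Rightarrow> ('e \<Rightarrow> 3) \<Rightarrow> 'e set" where
  "kept F b = {e\<in>F. b e \<noteq> 0}"

definition mono_edge :: "(nat \<Rightarrow> 'c) \<Rightarrow> nat set \<Rightarrow> bool" where
  "mono_edge c e \<longleftrightarrow> (\<forall>u\<in>e. \<forall>v\<in>e. c u = c v)"

lemma three_uniform_finite: "three_uniform n E \<Longrightarrow> finite E"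
  unfolding three_uniform_def by (rule finite_subset[of _ "Pow {1..n}"]) auto

lemma three_colorable_kept_edge_sum:
  assumes "three_uniform n F"
  shows "three_colorable n (kept F (restrict (edge_sum x) F))"
proof -
  \<comment> \<open>Renames the three residues as the colors 1, 2, 3.\<close>
  obtain h where h: "bij_betw h (UNIV :: 3 set) {1, 2, 3 :: nat}"
    using finite_same_card_bij[of "UNIV :: 3 set" "{1, 2, 3 :: nat}"] by auto
  have not_mono: "\<exists>u\<in>e. \<exists>v\<in>e. h (x u) \<noteq> h (x v)" if e: "e \<in> kept F (restrict (edge_sum x) F)" for e
  proof (rule ccontr)
    assume "\<not> ?thesis"
    then have same: "x u = x v" if "u \<in> e" "v \<in> e" for u v
      using that injD[OF bij_betw_imp_inj_on[OF h]] by blast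
    have c: "card e = 3" using e assms by (auto simp: kept_def three_uniform_def)
    then have "e \<noteq> {}" by auto
    then obtain u where u: "u \<in> e" by blast
    have "edge_sum x e = (\<Sum>v\<in>e. x u)" unfolding edge_sum_def by (intro sum.cong refl same u)
    also have "\<dots> = 3 * x u" using c by simp
    also have "(3 :: 3) = 0" by simp
    finally show False using e by (auto simp: kept_def)
  qed
  have "(\<lambda>v. h (x v)) \<in> {1..n} \<rightarrow> {1, 2, 3}"
    using bij_betw_imp_surj_on[OF h] by auto
  then show ?thesis
    unfolding three_colorable_def by (rule bexI[rotated]) (intro ballI not_mono)
qed

text \<open>A proper coloring of \<open>E'\<close> makes at least \<open>n\<close> hyperedges of the
  input monochromatic. None of them lies in \<open>E'\<close>, so the distance is at least
  \<open>n / (d * n) = 1 / d\<close>.\<close>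

lemma far_from_kept:
  assumes F: "three_uniform n F" and n: "n > 0" and d: "d > 0" and \<epsilon>: "\<epsilon> < 1 / real d"
    and many: "\<And>c. c \<in> {1..n} \<rightarrow>\<^sub>E {1, 2, 3 :: nat} \<Longrightarrow> card {e \<in> kept F b. mono_edge c e} \<ge> n"
  shows "far_from three_colorable d \<epsilon> n (kept F b)"
  unfolding far_from_def
proof (intro allI impI; elim conjE)
  fix E' assume E': "three_uniform n E'" "three_colorable n E'"
  then obtain c where c: "c \<in> {1..n} \<rightarrow> {1, 2, 3 :: nat}" "\<forall>e\<in>E'. \<exists>u\<in>e. \<exists>v\<in>e. c u \<noteq> c v"
    unfolding three_colorable_def by blast
  then have not_mono: "\<not> mono_edge c e" if "e \<in> E'" for e using that by (simp add: mono_edge_def)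
  have fin: "finite (kept F b)" using three_uniform_finite[OF F] by (simp add: kept_def)
  \<comment> \<open>Colorings are made extensional so that there are only \<open>3 ^ n\<close> of
    them for the union bound.\<close>
  let ?c = "restrict c {1..n}"
  have "n \<le> card {e \<in> kept F b. mono_edge ?c e}"
    by (rule many) (use c(1) in auto)
  also have "\<dots> \<le> card (kept F b - E')"
  proof (rule card_mono)
    have "mono_edge c e" if "e \<in> kept F b" "mono_edge ?c e" for e
    proof -
      have "e \<subseteq> {1..n}" using that F by (auto simp: kept_def three_uniform_def)
      then have "restrict c {1..n} u = c u" if "u \<in> e" for u using that by auto
      then show ?thesis using that(2) unfolding mono_edge_def by metis
    qed
    then show "{e \<in> kept F b. mono_edge ?c e} \<subseteq> kept F b - E'" using not_mono by auto
  qed (use fin in simp)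
  finally have "real n \<le> real (card (kept F b - E') + card (E' - kept F b))" by simp
  then have "real n / (real d * real n) \<le> hdist d n (kept F b) E'"
    unfolding hdist_def by (rule divide_right_mono) simp
  moreover have "real n / (real d * real n) = 1 / real d" using n by simp
  ultimately show "\<epsilon> < hdist d n (kept F b) E'" using \<epsilon> by simp
qed

text \<open>Union bound over colorings. Each monochromatic hyperedge survives with probability 2/3,
  so its factor in the Chernoff bound is 1/3 + (2/3)/2 = 2/3. With \<open>6 * n\<close> of them,
  \<open>3 ^ n\<close> colorings fail with probability at most
  \<open>3 ^ n * 2 ^ n * (2/3) ^ (6 * n) = (128/243) ^ n\<close>, which is below 1/3 from
  \<open>n = 2\<close> on.\<close>

lemma card_colored_few_mono:
  assumes F: "three_uniform n F" and n: "n \<ge> 2"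
    and many: "\<And>c. c \<in> {1..n} \<rightarrow>\<^sub>E {1, 2, 3 :: nat} \<Longrightarrow> card {e \<in> F. mono_edge c e} \<ge> 6 * n"
  shows "real (card {b \<in> F \<rightarrow>\<^sub>E (UNIV :: 3 set). \<exists>c \<in> {1..n} \<rightarrow>\<^sub>E {1, 2, 3 :: nat}.
            card {e \<in> kept F b. mono_edge c e} < n}) < 3 ^ card F / 3"
proof -
  let ?C = "{1..n} \<rightarrow>\<^sub>E {1, 2, 3 :: nat}"
  let ?B = "\<lambda>c. {b \<in> F \<rightarrow>\<^sub>E (UNIV :: 3 set). card {e \<in> kept F b. mono_edge c e} < n}"
  have fF: "finite F" using three_uniform_finite[OF F] .
  have C: "finite ?C" "card ?C = 3 ^ n" by (simp_all add: finite_PiE card_PiE numeral_3_eq_3)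
  have one: "real (card (?B c)) \<le> (128/243) ^ n / 3 ^ n * 3 ^ card F" if c: "c \<in> ?C" for c
  proof -
    \<comment> \<open>With this choice the hits are exactly the monochromatic hyperedges that are
      kept.\<close>
    define Y where "Y e = (if mono_edge c e then {r. r \<noteq> (0::3)} else {})" for e
    have "{r. r \<noteq> (0::3)} = UNIV - {0}" by auto
    then have two: "card {r. r \<noteq> (0::3)} = 2" by (simp add: card_Diff_singleton)
    have "{e \<in> kept F b. mono_edge c e} = {e\<in>F. b e \<in> Y e}" for b
      by (auto simp: kept_def Y_def)
    then have "real (card (?B c)) \<le> 2 ^ n * (\<Prod>e\<in>F. real (card (UNIV :: 3 set)) - real (card (Y e)) / 2)"
      using card_few_hits[OF fF, of "UNIV :: 3 set" Y n] by simp
    also have "(\<Prod>e\<in>F. real (card (UNIV :: 3 set)) - real (card (Y e)) / 2)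
               = (\<Prod>e\<in>F. 3 * (if mono_edge c e then 2/3 else 1))"
      by (rule prod.cong) (auto simp: Y_def two)
    also have "\<dots> = 3 ^ card F * (2/3) ^ card {e\<in>F. mono_edge c e}"
      using fF by (simp add: prod.distrib prod.If_cases Int_def)
    also have "\<dots> \<le> 3 ^ card F * (2/3) ^ (6 * n)"
      using many[OF c] by (intro mult_left_mono power_decreasing) auto
    also have "2 ^ n * (3 ^ card F * (2/3) ^ (6 * n)) = (128/243) ^ n / 3 ^ n * (3::real) ^ card F"
    proof -
      have "(2/3::real) ^ (6 * n) = (64/729) ^ n" by (simp add: power_mult power_divide)
      moreover have "(2::real) ^ n * (64/729) ^ n = (128/243) ^ n / 3 ^ n"
        by (simp flip: power_mult_distrib power_divide)
      ultimately show ?thesis by (simp only: mult.left_commute[of "2 ^ n"] mult.commute)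
    qed
    finally show ?thesis by simp
  qed
  have "{b \<in> F \<rightarrow>\<^sub>E (UNIV :: 3 set). \<exists>c \<in> ?C. card {e \<in> kept F b. mono_edge c e} < n}
        = (\<Union>c\<in>?C. ?B c)" by blast
  then have "real (card {b \<in> F \<rightarrow>\<^sub>E (UNIV :: 3 set). \<exists>c \<in> ?C. card {e \<in> kept F b. mono_edge c e} < n})
        \<le> (\<Sum>c\<in>?C. real (card (?B c)))"
    using card_UN_le[OF C(1), of ?B] by (simp flip: of_nat_sum)
  also have "\<dots> \<le> (\<Sum>c\<in>?C. (128/243) ^ n / 3 ^ n * 3 ^ card F)"
    by (rule sum_mono) (rule one)
  also have "\<dots> = (128/243) ^ n * 3 ^ card F" using C(2) by simp
  also have "\<dots> \<le> (128/243) ^ 2 * (3::real) ^ card F"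
    using n by (intro mult_right_mono power_decreasing) auto
  also have "\<dots> < 3 ^ card F / 3" by (simp add: power2_eq_square)
  finally show ?thesis .
qed

text \<open>Exchanging the sum over inputs with the expectation over the coins reduces a randomized
  tester to its deterministic trees.\<close>

lemma sum_prob_accepts_eq_0:
  fixes w :: "'b \<Rightarrow> real" and T :: "'t pmf"
  assumes "finite B" and zero: "\<And>t. t \<in> set_pmf T \<Longrightarrow> (\<Sum>b | b \<in> B \<and> R t b. w b) = 0"
  shows "(\<Sum>b\<in>B. w b * measure_pmf.prob T {t. R t b}) = 0"
proof -
  have int: "integrable (measure_pmf T) (\<lambda>t. w b * indicator {t. R t b} t :: real)" for b
    by (intro integrable_mult_right measure_pmf.integrable_const_bound[where B = 1])
      (auto simp: indicator_def)
  have "(\<Sum>b\<in>B. w b * measure_pmf.prob T {t. R t b})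
        = (\<Sum>b\<in>B. \<integral>t. w b * indicator {t. R t b} t \<partial>measure_pmf T)" by simp
  also have "\<dots> = (\<integral>t. (\<Sum>b\<in>B. w b * indicator {t. R t b} t) \<partial>measure_pmf T)"
    by (rule Bochner_Integration.integral_sum[symmetric]) (rule int)
  also have "\<dots> = (\<integral>t. 0 \<partial>measure_pmf T)"
  proof (rule integral_cong_AE)
    have "(\<Sum>b\<in>B. w b * indicator {t. R t b} t) = (\<Sum>b | b \<in> B \<and> R t b. w b)" for t
      using assms(1) by (intro sum.mono_neutral_cong_right) (auto simp: indicator_def)
    then show "AE t in measure_pmf T. (\<Sum>b\<in>B. w b * indicator {t. R t b} t) = 0"
      using zero by (auto simp: AE_measure_pmf_iff)
  qed auto
  finally show ?thesis by simp
qed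

text \<open>If \<open>d * q \<le> k\<close>, the mean acceptance probability is the same for uniform
  \<open>b\<close> as for the edge sums of uniform \<open>x\<close>. The latter mean is at least
  2/3; the former is below 1/3 + 1/3, since less than a third of all \<open>b\<close> fail to give a
  far input.\<close>

lemma tester_query_bound:
  assumes F: "three_uniform n F" and deg: "\<And>v. card {e\<in>F. v \<in> e} \<le> d"
    and many: "\<And>c. c \<in> {1..n} \<rightarrow>\<^sub>E {1, 2, 3 :: nat} \<Longrightarrow> card {e \<in> F. mono_edge c e} \<ge> 6 * n"
    and un: "\<And>K. K \<subseteq> F \<Longrightarrow> K \<noteq> {} \<Longrightarrow> card K \<le> k \<Longrightarrow> unique_neighbor K"
    and n: "n \<ge> 2" and d: "d > 0" and \<epsilon>: "\<epsilon> < 1 / real d"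
    and T: "is_tester three_colorable d \<epsilon> n T" "makes_at_most d n T q"
  shows "k < d * q"
proof (rule ccontr)
  assume "\<not> k < d * q"
  then have dq: "d * q \<le> k" by simp
  let ?B = "F \<rightarrow>\<^sub>E (UNIV :: 3 set)" and ?X = "{1..n} \<rightarrow>\<^sub>E (UNIV :: 3 set)"
  let ?M = "\<lambda>x :: nat \<Rightarrow> 3. restrict (edge_sum x) F"
  have fF: "finite F" using three_uniform_finite[OF F] .
  have B: "finite ?B" "card ?B = 3 ^ card F" and X: "finite ?X" "card ?X = 3 ^ n"
    using fF by (auto simp: finite_PiE card_PiE)
  have M: "?M ` ?X \<subseteq> ?B" by auto
  define A where "A b = incidence_list d (kept F b)" for b
  have input: "three_uniform n (kept F b) \<and> represents d n (kept F b) (A b)" for b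
  proof
    show "three_uniform n (kept F b)" using F by (auto simp: three_uniform_def kept_def)
    show "represents d n (kept F b) (A b)"
      unfolding A_def
    proof (rule represents_incidence_list)
      show "finite (kept F b)" using fF by (simp add: kept_def)
      show "card {e \<in> kept F b. v \<in> e} \<le> d" for v
        using fF by (intro order_trans[OF card_mono deg[of v]]) (auto simp: kept_def)
    qed
  qed
  define p where "p b = measure_pmf.prob T {t. accepts t (A b)}" for b
  \<comment> \<open>The uniform distribution on \<open>b\<close> minus the distribution of the edge
    sums of a uniform \<open>x\<close>.\<close>
  define w where "w b = 1 / 3 ^ card F - real (card {x\<in>?X. ?M x = b}) / 3 ^ n" for b
  have fiber: "(\<Sum>b\<in>?B. real (card {x\<in>?X. ?M x = b}) * g b) = (\<Sum>x\<in>?X. g (?M x))" for g :: "_ \<Rightarrow> real"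
  proof -
    have "(\<Sum>x\<in>?X. g (?M x)) = (\<Sum>b\<in>?B. \<Sum>x | x \<in> ?X \<and> ?M x = b. g (?M x))"
      using sum.group[OF X(1) B(1) M, of "\<lambda>x. g (?M x)"] by simp
    also have "\<dots> = (\<Sum>b\<in>?B. \<Sum>x | x \<in> ?X \<and> ?M x = b. g b)"
      by (intro sum.cong) auto
    finally show ?thesis by simp
  qed
  \<comment> \<open>Both distributions have marginal probability \<open>1 / 3 ^ card K\<close> for
    every pattern on \<open>K\<close>, the second one by the unique neighbor property of the
    subfamilies of \<open>K\<close>.\<close>
  have zero: "(\<Sum>b | b \<in> ?B \<and> (\<forall>e\<in>K. b e = b\<^sub>0 e). w b) = 0"
    if K: "K \<subseteq> F" "card K \<le> k" and b0: "b\<^sub>0 \<in> ?B" for K b\<^sub>0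
  proof -
    let ?P = "\<lambda>b. \<forall>e\<in>K. b e = b\<^sub>0 e"
    have fK: "finite K" using K fF finite_subset by blast
    have "(\<Sum>b | b \<in> ?B \<and> ?P b. w b) = (\<Sum>b\<in>?B. w b * of_bool (?P b))"
      using B(1) by (intro sum.mono_neutral_cong_left) auto
    also have "\<dots> = (\<Sum>b\<in>?B. of_bool (?P b)) / 3 ^ card F
        - (\<Sum>b\<in>?B. real (card {x\<in>?X. ?M x = b}) * of_bool (?P b)) / 3 ^ n"
      by (simp add: w_def left_diff_distrib sum_subtractf sum_divide_distrib)
    also have "(\<Sum>b\<in>?B. of_bool (?P b)) = real (card {b\<in>?B. ?P b})"
      using B(1) by (simp add: Int_def)
    also have "\<dots> = 3 ^ card F / 3 ^ card K"
    proof -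
      have "real (card {b\<in>?B. ?P b}) * 3 ^ card K = 3 ^ card F"
        using arg_cong[OF card_PiE_agree[OF fF K(1) b0], of real] by simp
      then show ?thesis by (simp add: field_simps)
    qed
    also have "(\<Sum>b\<in>?B. real (card {x\<in>?X. ?M x = b}) * of_bool (?P b))
               = (\<Sum>x\<in>?X. of_bool (?P (?M x)))" by (rule fiber)
    also have "\<dots> = real (card {x\<in>?X. \<forall>e\<in>K. edge_sum x e = b\<^sub>0 e})"
      using X(1) K(1) by (subst sum_of_bool_eq) (auto intro!: arg_cong[where f = card])
    also have "\<dots> = 3 ^ n / 3 ^ card K"
    proof -
      have "card {x\<in>?X. \<forall>e\<in>K. edge_sum x e = b\<^sub>0 e} * 3 ^ card K = 3 ^ card {1..n}"
      proof (rule card_edge_sum_agree[OF _ fK])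
        show "e \<subseteq> {1..n}" if "e \<in> K" for e using that K F by (auto simp: three_uniform_def)
        show "unique_neighbor K'" if "K' \<subseteq> K" "K' \<noteq> {}" for K'
          using that K fK card_mono[of K K'] by (intro un) auto
      qed simp
      from arg_cong[OF this, of real] show ?thesis by (simp add: field_simps)
    qed
    finally show ?thesis by simp
  qed
  have "(\<Sum>b\<in>?B. w b * p b) = 0"
    unfolding p_def
  proof (rule sum_prob_accepts_eq_0[OF B(1)])
    fix t assume t: "t \<in> set_pmf T"
    define N where "N i = {e\<in>F. i \<in> e}" for i
    \<comment> \<open>Nothing is revealed at the start. The zero assignment only supplies a
      reference point in \<open>?B\<close>.\<close>
    have "(\<Sum>b | b \<in> ?B \<and> (\<forall>e\<in>{}. b e = restrict (\<lambda>_. 0) F e) \<and> accepts t (A b). w b) = 0"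
    proof (rule sum_accepting_eq_0[where B = ?B and N = N and F = F and d = d and q = q and k = k])
      show "A b i = A b' i" if "\<forall>e\<in>N i. b e = b' e" for b b' i
        unfolding A_def using that by (intro incidence_list_cong) (auto simp: kept_def N_def)
      show "num_queries t (A b) \<le> q" for b
        using T(2) input[of b] t unfolding makes_at_most_def by blast
    qed (use B fF dq zero deg in \<open>auto simp: N_def\<close>)
    then show "(\<Sum>b | b \<in> ?B \<and> accepts t (A b). w b) = 0" by simp
  qed
  moreover have "(\<Sum>b\<in>?B. w b * p b) = (\<Sum>b\<in>?B. p b) / 3 ^ card F
      - (\<Sum>x\<in>?X. p (?M x)) / 3 ^ n"
    unfolding fiber[symmetric]
    by (simp add: w_def left_diff_distrib sum_subtractf sum_divide_distrib)
  ultimately have eq: "(\<Sum>b\<in>?B. p b) / 3 ^ card F = (\<Sum>x\<in>?X. p (?M x)) / 3 ^ n"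
 by simp
  have "(\<Sum>x\<in>?X. p (?M x)) \<ge> (\<Sum>x\<in>?X. 2/3)"
  proof (rule sum_mono)
    fix x
    show "2/3 \<le> p (?M x)" unfolding p_def
      using T(1) input[of "?M x"] three_colorable_kept_edge_sum[OF F, of x]
      unfolding is_tester_def by blast
  qed
  then have yes: "(\<Sum>x\<in>?X. p (?M x)) / 3 ^ n \<ge> 2/3" using X(2) by (simp add: field_simps)
  define bad where "bad = {b \<in> ?B. \<exists>c \<in> {1..n} \<rightarrow>\<^sub>E {1, 2, 3 :: nat}. card {e \<in> kept F b. mono_edge c e} < n}"
  have "(\<Sum>b\<in>?B. p b) \<le> (\<Sum>b\<in>?B. 1/3 + of_bool (b \<in> bad))"
  proof (rule sum_mono)
    fix b assume b: "b \<in> ?B"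
    show "p b \<le> 1/3 + of_bool (b \<in> bad)"
    proof (cases "b \<in> bad")
      case True
      have "p b \<le> 1" by (simp add: p_def)
      then show ?thesis using True by simp
    next
      case False
      then have "far_from three_colorable d \<epsilon> n (kept F b)"
        using b n by (intro far_from_kept[OF F _ d \<epsilon>]) (auto simp: bad_def not_less)
      then have "p b \<le> 1/3" unfolding p_def
        using T(1) input[of b] unfolding is_tester_def by blast
      then show ?thesis by simp
    qed
  qed
  also have "\<dots> = 3 ^ card F / 3 + real (card bad)"
    using B by (simp add: sum.distrib bad_def Int_def)
  also have "\<dots> < 3 ^ card F / 3 + 3 ^ card F / 3"
    unfolding bad_def using card_colored_few_mono[OF F n many] by simp
  finally have "(\<Sum>b\<in>?B. p b) / 3 ^ card F < 2/3" by (simp add: field_simps)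
  then show False using eq yes by simp
qed

subsection \<open>Random expanding hypergraphs\<close>

lemma six_times_choose_3: "6 * (n choose 3) = n * (n - 1) * (n - 2)"
proof -
  have "3 * (n choose 3) = n * ((n - 1) choose 2)"
    using binomial_absorption[of 2 n] by simp
  moreover have "2 * ((n - 1) choose 2) = (n - 1) * (n - 2)"
    using binomial_absorption[of 1 "n - 1"] by (simp add: numeral_2_eq_2)
  moreover have "6 * (n choose 3) = 2 * (3 * (n choose 3))" by simp
  ultimately show ?thesis by (simp only: mult.left_commute[of 2 n] mult.assoc)
qed

text \<open>For \<open>u \<le> n\<close> each of the ratios \<open>u / n\<close>,
  \<open>(u - 1) / (n - 1)\<close> and \<open>(u - 2) / (n - 2)\<close> is at most
  \<open>u / n\<close>.\<close>

lemma choose_3_le: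
  assumes "u \<le> n" "n \<ge> 1"
  shows "real (u choose 3) \<le> (real u / real n) ^ 3 * real (n choose 3)"
proof (cases "u \<ge> 3")
  case False
  then show ?thesis by (simp add: binomial_eq_0)
next
  case True
  have e: "6 * real (k choose 3) = real k * (real k - 1) * (real k - 2)" if "k \<ge> 3" for k
    using arg_cong[OF six_times_choose_3[of k], of real] that by (simp add: of_nat_diff)
  have un: "3 \<le> real u" "real u \<le> real n" using True assms by auto
  have "real n * (real u - 1) \<le> real u * (real n - 1)" "real n * (real u - 2) \<le> real u * (real n - 2)"
    using un by (auto simp: algebra_simps)
  then have "(real n * (real u - 1)) * (real n * (real u - 2)) \<le> (real u * (real n - 1)) * (real u * (real n - 2))"
    using un by (rule_tac mult_mono) auto
  then have "real u * real n * ((real n * (real u - 1)) * (real n * (real u - 2)))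
      \<le> real u * real n * ((real u * (real n - 1)) * (real u * (real n - 2)))"
    by (intro mult_left_mono) auto
  also have "real u * real n * ((real n * (real u - 1)) * (real n * (real u - 2)))
      = real n ^ 3 * (6 * real (u choose 3))"
    unfolding e[OF True] by (simp add: power3_eq_cube mult_ac)
  also have "real u * real n * ((real u * (real n - 1)) * (real u * (real n - 2)))
      = real u ^ 3 * (6 * real (n choose 3))"
    using True assms by (subst e) (auto simp: power3_eq_cube mult_ac)
  finally have "real n ^ 3 * (6 * real (u choose 3)) \<le> real u ^ 3 * (6 * real (n choose 3))" .
  then show ?thesis using assms by (simp add: power_divide field_simps)
qed

text \<open>From \<open>n \<ge> 40\<close> on, \<open>u - 1\<close> and \<open>u - 2\<close> are
  still at least \<open>n / 5\<close>. This gives the factor 4 * 5 * 5 = 100, rounded up to a power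
  of two.\<close>

lemma choose_3_ge:
  assumes "n \<le> 4 * u" "n \<ge> 40"
  shows "real (n choose 3) \<le> 128 * real (u choose 3)"
proof -
  have e: "6 * real (k choose 3) = real k * (real k - 1) * (real k - 2)" if "k \<ge> 3" for k
    using arg_cong[OF six_times_choose_3[of k], of real] that by (simp add: of_nat_diff)
  have un: "40 \<le> real n" "real n / 4 \<le> real u" "real n / 5 \<le> real u - 1" "real n / 5 \<le> real u - 2"
    using assms by auto
  have "real n * (real n - 1) * (real n - 2) \<le> real n * real n * real n"
    using un by (intro mult_mono) auto
  also have "\<dots> \<le> 128 * (real n / 4 * (real n / 5) * (real n / 5))" by simp
  also have "\<dots> \<le> 128 * (real u * (real u - 1) * (real u - 2))"
    using un by (intro mult_left_mono mult_mono) auto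
  finally show ?thesis using e[of u] e[of n] assms by simp
qed

text \<open>Compare one term of the exponential series at \<open>k\<close> with its sum, and use
  that e is at most 3.\<close>

lemma power_self_le_fact: "real k ^ k \<le> 3 ^ k * fact k"
proof -
  have "real k ^ k / fact k \<le> exp (real k)"
  proof -
    have "(\<Sum>i\<in>{k}. real k ^ i /\<^sub>R fact i) \<le> (\<Sum>i. real k ^ i /\<^sub>R fact i)"
      by (intro sum_le_suminf summable_exp_generic) auto
    then show ?thesis by (simp add: exp_def divide_inverse_commute)
  qed
  also have "exp (real k) = exp 1 ^ k" by (simp flip: exp_of_nat_mult)
  also have "\<dots> \<le> 3 ^ k" by (intro power_mono exp_le) auto
  finally show ?thesis by (simp add: field_simps)
qed

lemma binomial_le_power_divide:
  assumes "k \<ge> 1"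
  shows "real (n choose k) \<le> (3 * real n / real k) ^ k"
proof -
  have "real (n choose k) * real k ^ k \<le> real (n choose k) * (3 ^ k * fact k)"
    by (intro mult_left_mono power_self_le_fact) auto
  also have "\<dots> = 3 ^ k * real ((n choose k) * fact k)" by simp
  also have "\<dots> \<le> 3 ^ k * real (n ^ k)"
    by (intro mult_left_mono of_nat_mono binomial_fact_pow) auto
  finally show ?thesis using assms by (simp add: power_divide power_mult_distrib field_simps)
qed

text \<open>
  Summand of the first moment over \<open>s\<close> hyperedges contained in a set of \<open>u\<close> vertices.  The proof
  bounds its square, which avoids the half-integral exponent \<open>3s/2\<close>.
\<close>

lemma first_moment_term_le:
  assumes s: "s \<ge> 1" "2 ^ 36 * s \<le> n" and u: "u = 3 * s div 2"
  shows "real ((2048 * n) choose s) * real (n choose u) * (real u / real n) ^ (3 * s) \<le> (1/4) ^ s"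
    (is "?a * ?b * ?c \<le> _")
proof -
  have u1: "u \<ge> 1" "2 * u \<le> 3 * s" using s u by auto
  then have un: "u \<le> n" "n > 0" using s by auto
  \<comment> \<open>In terms of the density \<open>z\<close>, the square of the term is at most a
    constant times \<open>z\<close>, to the power \<open>s\<close>: the choice of hyperedges
    contributes \<open>z\<close> to the power -2, the remaining factors
    \<open>z ^ 3\<close>.\<close>
  define z where "z = real s / real n"
  have z: "0 < z" "z \<le> 1 / 2 ^ 36" using s un by (auto simp: z_def field_simps)
  have "?a \<le> (6144 / z) ^ s"
    using binomial_le_power_divide[OF s(1), of "2048 * n"] by (simp add: z_def)
  then have "?a\<^sup>2 \<le> ((6144 / z) ^ s)\<^sup>2" by (intro power_mono) auto
  also have "\<dots> = ((6144 / z)\<^sup>2) ^ s" by (metis power_mult mult.commute)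
  finally have a: "?a\<^sup>2 \<le> (6144\<^sup>2 / z\<^sup>2) ^ s" unfolding power_divide .
  have "?b * ?c \<le> (3 * real n / real u) ^ u * (real u / real n) ^ (3 * s)"
    by (intro mult_right_mono binomial_le_power_divide u1) auto
  also have "\<dots> = 3 ^ u * ((real n / real u) ^ u * (real u / real n) ^ u) * (real u / real n) ^ (3 * s - u)"
  proof -
    have "(real u / real n) ^ (3 * s) = (real u / real n) ^ u * (real u / real n) ^ (3 * s - u)"
      using u1 by (simp flip: power_add)
    moreover have "(3 * real n / real u) ^ u = 3 ^ u * (real n / real u) ^ u"
      by (simp flip: power_mult_distrib)
    ultimately show ?thesis by (simp only: mult_ac)
  qed
  also have "(real n / real u) ^ u * (real u / real n) ^ u = 1"
    using u1 un by (simp flip: power_mult_distrib)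
  finally have "(?b * ?c)\<^sup>2 \<le> (3 ^ u * (real u / real n) ^ (3 * s - u))\<^sup>2"
    by (intro power_mono) auto
  also have "\<dots> = 3 ^ (2 * u) * (real u / real n) ^ (2 * (3 * s - u))"
    by (simp add: power_mult_distrib mult.commute flip: power_mult)
  \<comment> \<open>Both estimates use \<open>2 * u \<le> 3 * s\<close>: the exponent of 3 grows,
    and the exponent of \<open>u / n \<le> 1\<close> drops to \<open>3 * s\<close>.\<close>
  also have "\<dots> \<le> 3 ^ (3 * s) * (real u / real n) ^ (3 * s)"
    using u1 un by (rule_tac mult_mono[OF power_increasing power_decreasing]) auto
  also have "\<dots> \<le> 3 ^ (3 * s) * (3 / 2 * z) ^ (3 * s)"
  proof (intro mult_left_mono power_mono)
    show "real u / real n \<le> 3 / 2 * z" using u1 un by (simp add: z_def field_simps)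
  qed auto
  also have "\<dots> = (3 ^ 3 * (3 / 2 * z) ^ 3) ^ s" by (simp only: power_mult power_mult_distrib)
  also have "3 ^ 3 * (3 / 2 * z) ^ 3 = 729 / 8 * z ^ 3" by (simp add: power3_eq_cube)
  finally have bc: "(?b * ?c)\<^sup>2 \<le> (729 / 8 * z ^ 3) ^ s" .
  have "(?a * (?b * ?c))\<^sup>2 = ?a\<^sup>2 * (?b * ?c)\<^sup>2" by (rule power_mult_distrib)
  also have "\<dots> \<le> (6144\<^sup>2 / z\<^sup>2) ^ s * (729 / 8 * z ^ 3) ^ s"
    by (intro mult_mono a bc) auto
  also have "\<dots> = (6144\<^sup>2 / z\<^sup>2 * (729 / 8 * z ^ 3)) ^ s" by (simp only: power_mult_distrib)
  also have "6144\<^sup>2 / z\<^sup>2 * (729 / 8 * z ^ 3) = 6144\<^sup>2 * 729 / 8 * z"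
    using z by (simp add: power2_eq_square power3_eq_cube)
  \<comment> \<open>The threshold \<open>2 ^ 36\<close> comes from here: it makes the base at most
    1/16.\<close>
  also have "(6144\<^sup>2 * 729 / 8 * z) ^ s \<le> ((1/4)\<^sup>2) ^ s"
    using z by (rule_tac power_mono) (auto simp: power2_eq_square)
  also have "\<dots> = ((1/4) ^ s)\<^sup>2" by (simp add: mult.commute flip: power_mult)
  finally have "?a * (?b * ?c) \<le> (1/4) ^ s" by (rule power2_le_imp_le) simp
  then show ?thesis by (simp add: mult.assoc)
qed

section \<open>Counting bad families of random triples\<close>

definition triples :: "nat set \<Rightarrow> nat set set" where
  "triples V = {e. e \<subseteq> V \<and> card e = 3}"

lemma finite_triples: "finite V \<Longrightarrow> finite (triples V)"
  and card_triples: "finite V \<Longrightarrow> card (triples V) = card V choose 3"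
  by (auto simp: triples_def n_subsets intro: finite_subset[of _ "Pow V"])

text \<open>First moment bound: sum over the \<open>s\<close> indices in \<open>S\<close> and over
  the sets of \<open>3 * s div 2\<close> vertices that contain all their triples. The terms are at
  most \<open>(1/4) ^ s\<close>, and the geometric series from \<open>s = 1\<close> on stays below
  1/3. Triples are indexed with repetition so that they are independent.\<close>

lemma card_nonexpanding:
  fixes n :: nat
  assumes n: "n > 0"
  defines "I \<equiv> {..<2048 * n}" and "X \<equiv> triples {1..n}"
  shows "real (card {f \<in> I \<rightarrow>\<^sub>E X. \<exists>S\<subseteq>I. S \<noteq> {} \<and> 2 ^ 36 * card S \<le> n \<and> card (\<Union>(f ` S)) \<le> 3 * card S div 2})
         \<le> real (card X) ^ (2048 * n) / 3" (is "real (card ?bad) \<le> _")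
proof -
  define k where "k = n div 2 ^ 36"
  define Ev where "Ev S U = {f \<in> I \<rightarrow>\<^sub>E X. \<forall>i\<in>S. f i \<subseteq> U}" for S U
  define SS where "SS s = {S. S \<subseteq> I \<and> card S = s}" for s
  define UU where "UU s = {U. U \<subseteq> {1..n} \<and> card U = 3 * s div 2}" for s
  have fin: "finite I" "finite X" "finite (SS s)" "finite (UU s)" for s
    by (auto simp: I_def X_def SS_def UU_def finite_triples)
  have cX: "card X = n choose 3" by (simp add: X_def card_triples)
  have ev: "real (card (Ev S U)) \<le> (real (3 * s div 2) / real n) ^ (3 * s) * real (card X) ^ (2048 * n)"
    if S: "S \<in> SS s" and U: "U \<in> UU s" and s: "s \<le> k" for S U s
  proof -
    have fU: "finite U" using U by (auto simp: UU_def intro: finite_subset)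
    have u: "card U = 3 * s div 2" "card U \<le> n" using U card_mono[of "{1..n}" U] by (auto simp: UU_def)
    have S': "S \<subseteq> I" "finite S" "card S = s" using S fin(1) by (auto simp: SS_def intro: finite_subset)
    have "Ev S U = PiE I (\<lambda>i. if i \<in> S then triples U else X)" (is "_ = ?R")
    proof (intro set_eqI iffI)
      fix f assume "f \<in> Ev S U"
      then show "f \<in> ?R" by (auto simp: Ev_def PiE_iff X_def triples_def)
    next
      fix f assume f: "f \<in> ?R"
      have "f i \<in> triples U" if "i \<in> S" for i using PiE_mem[OF f, of i] that S' by auto
      moreover have "f i \<in> X" if "i \<in> I" for i
        using PiE_mem[OF f that] U by (auto simp: X_def triples_def UU_def split: if_splits)
      ultimately show "f \<in> Ev S U" using f by (auto simp: Ev_def PiE_iff triples_def)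
    qed
    then have "card (Ev S U) = (\<Prod>i\<in>I. if i \<in> S then card U choose 3 else card X)"
      using fin fU by (simp add: card_PiE if_distrib card_triples cong: if_cong)
    also have "\<dots> = (card U choose 3) ^ s * card X ^ card (I - S)"
      using fin S' by (simp add: prod.If_cases Diff_eq Int_absorb1)
    finally have "real (card (Ev S U)) = real (card U choose 3) ^ s * real (card X) ^ card (I - S)" by simp
    also have "\<dots> \<le> ((real (card U) / real n) ^ 3 * real (card X)) ^ s * real (card X) ^ card (I - S)"
      using choose_3_le[OF u(2)] n by (intro mult_right_mono power_mono) (auto simp: cX)
    also have "\<dots> = (real (card U) / real n) ^ (3 * s) * real (card X) ^ (s + card (I - S))"
      by (simp add: power_mult_distrib power_mult power_add)
    also have "s + card (I - S) = 2048 * n"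
      using S' fin(1) card_mono[of I S] by (simp add: card_Diff_subset) (simp add: I_def)
    finally show ?thesis by (simp add: u)
  qed
  have "?bad \<subseteq> (\<Union>s\<in>{1..k}. \<Union>S\<in>SS s. \<Union>U\<in>UU s. Ev S U)"
  proof
    fix f assume "f \<in> ?bad"
    then obtain S where f: "f \<in> I \<rightarrow>\<^sub>E X" and S: "S \<subseteq> I" "S \<noteq> {}" "2 ^ 36 * card S \<le> n"
      "card (\<Union>(f ` S)) \<le> 3 * card S div 2" by blast
    have "finite S" using S(1) fin(1) finite_subset by blast
    then have s: "card S \<in> {1..k}" using S by (auto simp: k_def less_eq_div_iff_mult_less_eq Suc_le_eq card_gt_0_iff mult.commute)
    \<comment> \<open>The union may be smaller than \<open>3 * card S div 2\<close>; it is padded to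
      exactly this size so that the sum runs over a single size \<open>u\<close>.\<close>
    have "\<Union>(f ` S) \<subseteq> {1..n}" using f S(1) by (fastforce simp: X_def triples_def)
    moreover have "3 * card S div 2 \<le> card {1..n}" using S(3) by simp
    ultimately obtain U where "\<Union>(f ` S) \<subseteq> U" "U \<subseteq> {1..n}" "card U = 3 * card S div 2"
      using exists_subset_between[OF S(4), of "{1..n}"] by auto
    then show "f \<in> (\<Union>s\<in>{1..k}. \<Union>S\<in>SS s. \<Union>U\<in>UU s. Ev S U)"
      using f S(1) by (intro UN_I[OF s] UN_I[of S] UN_I[of U]) (auto simp: SS_def UU_def Ev_def)
  qed
  then have "card ?bad \<le> card (\<Union>s\<in>{1..k}. \<Union>S\<in>SS s. \<Union>U\<in>UU s. Ev S U)"
    using fin by (intro card_mono) (auto simp: Ev_def finite_PiE)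
  also have "\<dots> \<le> (\<Sum>s\<in>{1..k}. \<Sum>S\<in>SS s. \<Sum>U\<in>UU s. card (Ev S U))"
    using fin by (intro order_trans[OF card_UN_le] sum_mono) auto
  finally have "real (card ?bad) \<le> (\<Sum>s\<in>{1..k}. \<Sum>S\<in>SS s. \<Sum>U\<in>UU s. real (card (Ev S U)))"
    unfolding of_nat_sum[symmetric] by (rule of_nat_mono)
  also have "\<dots> \<le> (\<Sum>s\<in>{1..k}. (1/4) ^ s * real (card X) ^ (2048 * n))"
  proof (rule sum_mono)
    fix s assume s: "s \<in> {1..k}"
    then have sn: "1 \<le> s" "2 ^ 36 * s \<le> n" by (auto simp: k_def less_eq_div_iff_mult_less_eq mult.commute)
    let ?r = "(real (3 * s div 2) / real n) ^ (3 * s) * real (card X) ^ (2048 * n)"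
    have "(\<Sum>S\<in>SS s. \<Sum>U\<in>UU s. real (card (Ev S U))) \<le> (\<Sum>S\<in>SS s. \<Sum>U\<in>UU s. ?r)"
      using s by (intro sum_mono ev) auto
    also have "\<dots> = real ((2048 * n) choose s) * real (n choose (3 * s div 2)) * ?r"
      by (simp add: SS_def UU_def n_subsets I_def)
    also have "\<dots> \<le> (1/4) ^ s * real (card X) ^ (2048 * n)"
      using mult_right_mono[OF first_moment_term_le[OF sn refl], of "real (card X) ^ (2048 * n)"]
      by (simp add: mult.assoc)
    finally show "(\<Sum>S\<in>SS s. \<Sum>U\<in>UU s. real (card (Ev S U))) \<le> (1/4) ^ s * real (card X) ^ (2048 * n)" .
  qed
  also have "\<dots> = (\<Sum>s\<in>{1..k}. (1/4) ^ s) * real (card X) ^ (2048 * n)"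
    by (rule sum_distrib_right[symmetric])
  also have "\<dots> \<le> 1 / 3 * real (card X) ^ (2048 * n)"
  proof (intro mult_right_mono)
    have "(\<Sum>s\<in>{1..k}. (1/4::real) ^ s) = (1 - (1/4) ^ k) / 3"
    proof (induction k)
      case (Suc k)
      have "(\<Sum>s\<in>{1..Suc k}. (1/4::real) ^ s) = (\<Sum>s\<in>{1..k}. (1/4) ^ s) + 1/4 * (1/4) ^ k" by simp
      moreover have "(1 - a) / 3 + 1/4 * a = (1 - 1/4 * a) / 3" for a :: real by (simp add: field_simps)
      ultimately show ?case using Suc by (simp only: power_Suc)
    qed simp
    then show "(\<Sum>s\<in>{1..k}. (1/4::real) ^ s) \<le> 1 / 3" by simp
  qed simp
  finally show ?thesis by simp
qed

text \<open>Union bound over the at most \<open>2 ^ n\<close> sets \<open>U\<close>. A random triple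
  lies in \<open>U\<close> with probability at least 1/128, so its Chernoff factor is at most
  255/256. Over \<open>2048 * n\<close> triples this beats the loss \<open>2 ^ (6 * n)\<close> and
  leaves \<open>(1/4) ^ n\<close> for each \<open>U\<close>.\<close>

lemma card_sparse:
  fixes n :: nat
  assumes n: "n \<ge> 40"
  defines "I \<equiv> {..<2048 * n}" and "X \<equiv> triples {1..n}"
  shows "real (card {f \<in> I \<rightarrow>\<^sub>E X. \<exists>U\<subseteq>{1..n}. n \<le> 4 * card U \<and> card {i\<in>I. f i \<subseteq> U} < 6 * n})
         \<le> real (card X) ^ (2048 * n) / 3" (is "real (card ?bad) \<le> _")
proof -
  define Ev where "Ev U = {f \<in> I \<rightarrow>\<^sub>E X. card {i\<in>I. f i \<subseteq> U} < 6 * n}" for U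
  define UU where "UU = {U. U \<subseteq> {1..n} \<and> n \<le> 4 * card U}"
  have fin: "finite I" "finite X" by (auto simp: I_def X_def finite_triples)
  have fU: "finite UU" unfolding UU_def by (rule finite_subset[of _ "Pow {1..n}"]) auto
  have "card UU \<le> card (Pow {1..n})" unfolding UU_def by (intro card_mono) auto
  then have cU: "real (card UU) \<le> 2 ^ n" using of_nat_mono[of "card UU" "2 ^ n"] by (simp add: card_Pow)
  have cX: "card X = n choose 3" by (simp add: X_def card_triples)
  \<comment> \<open>Here 2048 = 8 * 256 gives the bound \<open>exp (-8)\<close>, and e is at least
    2.\<close>
  have exp8: "(255/256 :: real) ^ 2048 \<le> 1/256"
  proof -
    have "(255/256 :: real) ^ 2048 \<le> exp (-1/256) ^ 2048"
      using exp_ge_add_one_self[of "-1/256 :: real"] by (intro power_mono) auto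
    also have "\<dots> = inverse (exp 1 ^ 8)" by (simp flip: exp_of_nat_mult exp_minus)
    also have "\<dots> \<le> inverse (2 ^ 8)"
      using exp_ge_add_one_self[of "1 :: real"] by (intro le_imp_inverse_le power_mono) auto
    finally show ?thesis by simp
  qed
  have ev: "real (card (Ev U)) \<le> (1/4) ^ n * real (card X) ^ (2048 * n)" if U: "U \<in> UU" for U
  proof -
    have fU: "finite U" using U by (auto simp: UU_def intro: finite_subset)
    have tU: "triples U \<subseteq> X" using U by (auto simp: triples_def X_def UU_def)
    have "{i\<in>I. f i \<subseteq> U} = {i\<in>I. f i \<in> triples U}" if "f \<in> I \<rightarrow>\<^sub>E X" for f
      using that by (auto simp: PiE_iff X_def triples_def)
    then have "Ev U = {f \<in> I \<rightarrow>\<^sub>E X. card {i\<in>I. f i \<in> triples U} < 6 * n}"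
      unfolding Ev_def by (metis (no_types, lifting))
    then have "real (card (Ev U)) \<le> 2 ^ (6 * n) * (\<Prod>i\<in>I. real (card X) - real (card (triples U)) / 2)"
      using card_few_hits[OF fin, of "\<lambda>_. triples U" "6 * n"] tU by simp
    also have "\<dots> = 64 ^ n * (real (card X) - real (card (triples U)) / 2) ^ (2048 * n)"
      by (simp add: power_mult I_def)
    also have "\<dots> \<le> 64 ^ n * (255/256 * real (card X)) ^ (2048 * n)"
    proof (intro mult_left_mono power_mono)
      show "real (card X) - real (card (triples U)) / 2 \<le> 255/256 * real (card X)"
        using choose_3_ge[of n "card U"] U n fU by (simp add: cX card_triples UU_def)
      have "real (card (triples U)) \<le> real (card X)" using tU fin by (simp add: card_mono)
      then show "0 \<le> real (card X) - real (card (triples U)) / 2" by linarith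
    qed auto
    also have "\<dots> = (64 * (255/256) ^ 2048) ^ n * real (card X) ^ (2048 * n)"
      unfolding power_mult_distrib power_mult by simp
    also have "\<dots> \<le> (1/4) ^ n * real (card X) ^ (2048 * n)"
      using exp8 by (intro mult_right_mono power_mono) auto
    finally show ?thesis .
  qed
  have "?bad \<subseteq> (\<Union>U\<in>UU. Ev U)" by (auto simp: UU_def Ev_def)
  then have "card ?bad \<le> card (\<Union>U\<in>UU. Ev U)"
    using fin fU by (intro card_mono) (auto simp: Ev_def finite_PiE)
  also have "\<dots> \<le> (\<Sum>U\<in>UU. card (Ev U))" by (rule card_UN_le[OF fU])
  finally have "real (card ?bad) \<le> (\<Sum>U\<in>UU. real (card (Ev U)))"
    unfolding of_nat_sum[symmetric] by (rule of_nat_mono)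
  also have "\<dots> \<le> (\<Sum>U\<in>UU. (1/4) ^ n * real (card X) ^ (2048 * n))" by (intro sum_mono ev)
  also have "\<dots> = real (card UU) * ((1/4) ^ n * real (card X) ^ (2048 * n))" by simp
  also have "\<dots> \<le> 2 ^ n * ((1/4) ^ n * real (card X) ^ (2048 * n))" using cU by (intro mult_right_mono) auto
  also have "\<dots> = (1/2) ^ n * real (card X) ^ (2048 * n)" by (simp flip: power_mult_distrib mult.assoc)
  also have "\<dots> \<le> (1/2) ^ 2 * real (card X) ^ (2048 * n)"
    using n by (intro mult_right_mono power_decreasing) auto
  also have "\<dots> \<le> real (card X) ^ (2048 * n) / 3" by (simp add: power2_eq_square)
  finally show ?thesis .
qed

text \<open>Each of the two bad sets contains at most a third of all functions, so some function
  avoids both.\<close>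

lemma expanding_triples_exist:
  fixes n :: nat
  assumes n: "n \<ge> 40"
  obtains f where "\<And>i. i < 2048 * n \<Longrightarrow> f i \<in> triples {1..n}"
    "\<And>S. S \<subseteq> {..<2048 * n} \<Longrightarrow> S \<noteq> {} \<Longrightarrow> 2 ^ 36 * card S \<le> n \<Longrightarrow> 3 * card S div 2 < card (\<Union>(f ` S))"
    "\<And>U. U \<subseteq> {1..n} \<Longrightarrow> n \<le> 4 * card U \<Longrightarrow> 6 * n \<le> card {i. i < 2048 * n \<and> f i \<subseteq> U}"
proof -
  let ?I = "{..<2048 * n}" and ?X = "triples {1..n}"
  let ?bad1 = "{f \<in> ?I \<rightarrow>\<^sub>E ?X. \<exists>S\<subseteq>?I. S \<noteq> {} \<and> 2 ^ 36 * card S \<le> n \<and> card (\<Union>(f ` S)) \<le> 3 * card S div 2}"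
  let ?bad2 = "{f \<in> ?I \<rightarrow>\<^sub>E ?X. \<exists>U\<subseteq>{1..n}. n \<le> 4 * card U \<and> card {i\<in>?I. f i \<subseteq> U} < 6 * n}"
  have fin: "finite (?I \<rightarrow>\<^sub>E ?X)" by (intro finite_PiE) (auto simp: finite_triples)
  have card: "real (card (?I \<rightarrow>\<^sub>E ?X)) = real (card ?X) ^ (2048 * n)" by (simp add: card_PiE)
  have pos: "real (card ?X) ^ (2048 * n) > 0" using n by (simp add: card_triples)
  have "real (card (?bad1 \<union> ?bad2)) \<le> real (card ?bad1) + real (card ?bad2)"
    using card_Un_le[of ?bad1 ?bad2] by linarith
  also have "\<dots> < real (card (?I \<rightarrow>\<^sub>E ?X))"
    using card_nonexpanding[of n] card_sparse[OF n] pos n card by linarith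
  finally have less: "card (?bad1 \<union> ?bad2) < card (?I \<rightarrow>\<^sub>E ?X)" by simp
  have fin_bad: "finite (?bad1 \<union> ?bad2)" using fin by simp
  have "\<not> ?I \<rightarrow>\<^sub>E ?X \<subseteq> ?bad1 \<union> ?bad2"
  proof
    assume "?I \<rightarrow>\<^sub>E ?X \<subseteq> ?bad1 \<union> ?bad2"
    from card_mono[OF fin_bad this] less show False by linarith
  qed
  then obtain f where f: "f \<in> ?I \<rightarrow>\<^sub>E ?X" "f \<notin> ?bad1" "f \<notin> ?bad2" by blast
  show ?thesis
  proof (rule that[of f])
    show "f i \<in> ?X" if "i < 2048 * n" for i using f(1) that by auto
    show "3 * card S div 2 < card (\<Union>(f ` S))" if "S \<subseteq> ?I" "S \<noteq> {}" "2 ^ 36 * card S \<le> n" for S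
    proof (rule ccontr)
      assume "\<not> ?thesis"
      then have "card (\<Union>(f ` S)) \<le> 3 * card S div 2" by (rule leI)
      then have "f \<in> ?bad1" by (intro CollectI conjI f(1) exI[of _ S] that)
      then show False using f(2) by contradiction
    qed
    show "6 * n \<le> card {i. i < 2048 * n \<and> f i \<subseteq> U}" if "U \<subseteq> {1..n}" "n \<le> 4 * card U" for U
    proof (rule ccontr)
      assume "\<not> ?thesis"
      then have "card {i\<in>?I. f i \<subseteq> U} < 6 * n" by simp
      then have "f \<in> ?bad2" by (intro CollectI conjI f(1) exI[of _ U] that)
      then show False using f(3) by contradiction
    qed
  qed
qed

subsection \<open>The base hypergraph\<close>

lemma sum_degree:
  assumes "finite I" "finite V" "\<And>i. i \<in> I \<Longrightarrow> f i \<subseteq> V"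
  shows "(\<Sum>v\<in>V. card {i\<in>I. v \<in> f i}) = (\<Sum>i\<in>I. card (f i))"
proof -
  have "(\<Sum>v\<in>V. card {i\<in>I. v \<in> f i}) = (\<Sum>v\<in>V. \<Sum>i\<in>I. of_bool (v \<in> f i))"
    using assms(1) by (simp add: Int_def)
  also have "\<dots> = (\<Sum>i\<in>I. \<Sum>v\<in>V. of_bool (v \<in> f i))" by (rule sum.swap)
  also have "\<dots> = (\<Sum>i\<in>I. card (f i))"
    using assms(2,3) by (intro sum.cong) (auto simp: Int_absorb1)
  finally show ?thesis .
qed

text \<open>If every vertex of the union lay in at least two hyperedges, double counting incidences
  would give \<open>2 * card (\<Union>K) \<le> 3 * card K\<close>.\<close>

lemma unique_neighborI:
  assumes K: "finite K" "K \<noteq> {}" "\<And>e. e \<in> K \<Longrightarrow> card e = 3" and exp: "3 * card K div 2 < card (\<Union>K)"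
  shows "unique_neighbor K"
proof (rule ccontr)
  assume no: "\<not> unique_neighbor K"
  have fin: "finite e" if "e \<in> K" for e using K(3)[OF that] by (metis card.infinite zero_neq_numeral)
  have "2 \<le> card {e\<in>K. v \<in> e}" if v: "v \<in> \<Union>K" for v
  proof -
    obtain e where e: "e \<in> K" "v \<in> e" using v by blast
    then obtain e' where e': "e' \<in> K" "v \<in> e'" "e' \<noteq> e" using no unfolding unique_neighbor_def by blast
    have "card {e, e'} \<le> card {e\<in>K. v \<in> e}" using e e' K(1) by (intro card_mono) auto
    then show ?thesis using e' by simp
  qed
  then have "(\<Sum>v\<in>\<Union>K. 2) \<le> (\<Sum>v\<in>\<Union>K. card {e\<in>K. v \<in> e})" by (rule sum_mono)
  also have "\<dots> = (\<Sum>e\<in>K. card e)"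
    using sum_degree[of K "\<Union>K" "\<lambda>e. e"] K(1) fin by auto
  also have "\<dots> = 3 * card K" using K(3) by simp
  finally show False using exp by simp
qed

lemma large_color_class:
  assumes "finite G" "\<And>v. v \<in> G \<Longrightarrow> c v \<in> {1, 2, 3 :: nat}"
  obtains a where "card G \<le> 3 * card {v\<in>G. c v = a}"
proof -
  have "c ` G \<subseteq> {1, 2, 3}" using assms(2) by blast
  then have "card G = (\<Sum>a\<in>{1, 2, 3}. card {v\<in>G. c v = a})"
    using sum.group[OF assms(1), of "{1, 2, 3}" c "\<lambda>_. 1::nat"] by simp
  then have "card G = card {v\<in>G. c v = 1} + card {v\<in>G. c v = 2} + card {v\<in>G. c v = 3}" by simp
  then have "card G \<le> 3 * card {v\<in>G. c v = 1} \<or> card G \<le> 3 * card {v\<in>G. c v = 2}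
      \<or> card G \<le> 3 * card {v\<in>G. c v = 3}" by linarith
  then show thesis using that by blast
qed

text \<open>Discard the triples that meet a vertex of high degree. Subfamilies keep the expansion,
  and some color class on the remaining vertices is still large enough to contain
  \<open>6 * n\<close> triples, none of which was discarded.\<close>

lemma base_hypergraph_exists:
  fixes n :: nat
  assumes n: "n \<ge> 2 ^ 37"
  obtains F where "three_uniform n F" "\<And>v. card {e\<in>F. v \<in> e} \<le> 24576"
    "\<And>c. c \<in> {1..n} \<rightarrow>\<^sub>E {1, 2, 3 :: nat} \<Longrightarrow> 6 * n \<le> card {e\<in>F. mono_edge c e}"
    "\<And>K. K \<subseteq> F \<Longrightarrow> K \<noteq> {} \<Longrightarrow> 2 ^ 36 * card K \<le> n \<Longrightarrow> unique_neighbor K"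
proof -
  let ?I = "{..<2048 * n}"
  have "n \<ge> 40" using n by simp
  then obtain f where f: "\<And>i. i \<in> ?I \<Longrightarrow> f i \<in> triples {1..n}"
    and exp: "\<And>S. S \<subseteq> ?I \<Longrightarrow> S \<noteq> {} \<Longrightarrow> 2 ^ 36 * card S \<le> n \<Longrightarrow> 3 * card S div 2 < card (\<Union>(f ` S))"
    and dense: "\<And>U. U \<subseteq> {1..n} \<Longrightarrow> n \<le> 4 * card U \<Longrightarrow> 6 * n \<le> card {i. i < 2048 * n \<and> f i \<subseteq> U}"
    by (rule expanding_triples_exist) auto
  have f3: "f i \<subseteq> {1..n}" "card (f i) = 3" if "i \<in> ?I" for i using f[OF that] by (auto simp: triples_def)
  \<comment> \<open>Two equal triples would span only 3 vertices, while expansion of a pair demands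
    more than \<open>3 * 2 div 2 = 3\<close>. Applying it to a pair requires
    \<open>n \<ge> 2 ^ 37\<close>.\<close>
  have inj: "inj_on f ?I"
  proof (rule inj_onI, rule ccontr)
    fix i j assume ij: "i \<in> ?I" "j \<in> ?I" "f i = f j" "i \<noteq> j"
    have "3 * card {i, j} div 2 < card (\<Union>(f ` {i, j}))" using ij n by (intro exp) auto
    then show False using ij f3(2)[OF ij(2)] by simp
  qed
  define deg where "deg v = card {i\<in>?I. v \<in> f i}" for v
  \<comment> \<open>The mean degree is 3 * 2048 = 6144. The threshold is four times the mean, so
    \<open>W\<close> contains at most a quarter of the vertices.\<close>
  define W where "W = {v\<in>{1..n}. deg v > 24576}"
  have fW: "finite W" by (simp add: W_def)
  have "(\<Sum>v\<in>W. 24576) \<le> (\<Sum>v\<in>W. deg v)" by (rule sum_mono) (simp add: W_def)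
  also have "\<dots> \<le> (\<Sum>v\<in>{1..n}. deg v)" by (rule sum_mono2) (auto simp: W_def)
  also have "\<dots> = (\<Sum>i\<in>?I. card (f i))" unfolding deg_def by (rule sum_degree) (use f3 in auto)
  also have "\<dots> = 6144 * n" using f3(2) by simp
  finally have cW: "4 * card W \<le> n" by simp
  define L where "L = {i\<in>?I. f i \<inter> W = {}}"
  have L: "L \<subseteq> ?I" by (auto simp: L_def)
  have fin: "finite (f ` L)" using L finite_subset by blast
  show ?thesis
  proof (rule that[of "f ` L"])
    show "three_uniform n (f ` L)" using f3 L by (auto simp: three_uniform_def)
    show "card {e \<in> f ` L. v \<in> e} \<le> 24576" for v
    proof (cases "v \<in> {1..n} \<and> v \<notin> W")
      case True
      have "card {e \<in> f ` L. v \<in> e} \<le> card (f ` {i\<in>?I. v \<in> f i})"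
        using L by (intro card_mono) auto
      also have "\<dots> \<le> deg v" unfolding deg_def by (rule card_image_le) simp
      also have "\<dots> \<le> 24576" using True by (auto simp: W_def not_less)
      finally show ?thesis .
    next
      case False
      have "v \<in> {1..n} \<and> v \<notin> W" if "i \<in> L" "v \<in> f i" for i
        using that f3(1)[of i] L by (auto simp: L_def)
      then have "{e \<in> f ` L. v \<in> e} = {}" using False by blast
      then show ?thesis by (simp only: card.empty)
    qed
    show "6 * n \<le> card {e \<in> f ` L. mono_edge c e}" if c: "c \<in> {1..n} \<rightarrow>\<^sub>E {1, 2, 3 :: nat}" for c
    proof -
      \<comment> \<open>At least \<open>3 * n / 4\<close> vertices remain outside \<open>W\<close>,
        so the largest color class among them has at least \<open>n / 4\<close> vertices.\<close>
      let ?G = "{1..n} - W"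
      obtain a where a: "card ?G \<le> 3 * card {v\<in>?G. c v = a}"
        by (rule large_color_class[of ?G c]) (use c in auto)
      let ?U = "{v\<in>?G. c v = a}"
      have "card ?G = n - card W" using fW by (subst card_Diff_subset) (auto simp: W_def)
      then have "n \<le> 4 * card ?U" using a cW by linarith
      then have "6 * n \<le> card {i. i < 2048 * n \<and> f i \<subseteq> ?U}" by (intro dense) auto
      also have "\<dots> = card (f ` {i. i < 2048 * n \<and> f i \<subseteq> ?U})"
        by (intro card_image[symmetric] inj_on_subset[OF inj]) auto
      also have "\<dots> \<le> card {e \<in> f ` L. mono_edge c e}"
        using fin by (intro card_mono) (auto simp: L_def mono_edge_def)
      finally show ?thesis .
    qed
    show "unique_neighbor K" if K: "K \<subseteq> f ` L" "K \<noteq> {}" "2 ^ 36 * card K \<le> n" for K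
    proof (rule unique_neighborI)
      obtain S where S: "S \<subseteq> L" "K = f ` S" using K(1) by (meson subset_imageE)
      have "card K = card S" unfolding S(2) by (rule card_image[OF inj_on_subset[OF inj]]) (use S L in auto)
      then show "3 * card K div 2 < card (\<Union>K)" using exp[of S] S K L by auto
      show "finite K" using K(1) fin finite_subset by blast
      show "card e = 3" if "e \<in> K" for e using that K(1) L f3(2) by blast
    qed (rule K(2))
  qed
qed

theorem theorem5:
  "\<exists>(d :: nat) (\<epsilon> :: real). d > 0 \<and> \<epsilon> > 0 \<and>
     (\<lambda>n. real (query_complexity three_colorable d \<epsilon> n)) \<in> \<Omega>(\<lambda>n. real n)"
proof (intro exI conjI)
  \<comment> \<open>The degree bound is that of the base hypergraph, and \<open>?\<epsilon>\<close>
    is half of \<open>1 / ?d\<close>, hence below the distance guaranteed for far inputs.\<close>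
  let ?d = "24576 :: nat" and ?\<epsilon> = "1/49152 :: real"
  show "(\<lambda>n. real (query_complexity three_colorable ?d ?\<epsilon> n)) \<in> \<Omega>(\<lambda>n. real n)"
  proof (rule landau_omega.bigI[of "1 / (24576 * 2 ^ 36)"])
    show "\<forall>\<^sub>F n in sequentially. norm (real (query_complexity three_colorable ?d ?\<epsilon> n))
            \<ge> 1 / (24576 * 2 ^ 36) * norm (real n)"
      using eventually_ge_at_top[of "2 ^ 37"]
    proof eventually_elim
      fix n :: nat assume n: "n \<ge> 2 ^ 37"
      let ?q = "query_complexity three_colorable ?d ?\<epsilon> n"
      obtain T where T: "is_tester three_colorable ?d ?\<epsilon> n T" "makes_at_most ?d n T ?q"
        using query_complexity_attained[of ?\<epsilon> three_colorable ?d n] by auto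
      obtain F where F: "three_uniform n F" "\<And>v. card {e\<in>F. v \<in> e} \<le> 24576"
        "\<And>c. c \<in> {1..n} \<rightarrow>\<^sub>E {1, 2, 3 :: nat} \<Longrightarrow> 6 * n \<le> card {e\<in>F. mono_edge c e}"
        "\<And>K. K \<subseteq> F \<Longrightarrow> K \<noteq> {} \<Longrightarrow> 2 ^ 36 * card K \<le> n \<Longrightarrow> unique_neighbor K"
        using base_hypergraph_exists[OF n] by blast
      \<comment> \<open>Families of up to \<open>n div 2 ^ 36\<close> hyperedges have a unique
        neighbor, so this is the number of coordinates that queries must exceed.\<close>
      have "n div 2 ^ 36 < ?d * ?q"
      proof (rule tester_query_bound[OF F(1,2,3) _ _ _ _ T])
        show "unique_neighbor K" if "K \<subseteq> F" "K \<noteq> {}" "card K \<le> n div 2 ^ 36" for K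
          using that by (intro F(4)) (auto simp: less_eq_div_iff_mult_less_eq mult.commute)
      qed (use n in auto)
      then have "n < 2 ^ 36 * (?d * ?q)" by (simp add: div_less_iff_less_mult mult.commute)
      then have "real n < real (2 ^ 36 * (?d * ?q))" by (simp only: of_nat_less_iff)
      then show "norm (real ?q) \<ge> 1 / (24576 * 2 ^ 36) * norm (real n)" by simp
    qed
  qed simp
qed auto

end
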